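(* Let $\{g(\vartheta;a,b,c),\,nb(\varpi;r,\lambda)\}$ be a matched pair, with scaled cumulants $\overline{\gamma}(n)$ and $\overline{\eta}(n)$, $n\ge1$. Then the cumulants of the two distributions are related, for all $n\ge 0$, by the reciprocal linear combinations $$\overline{\gamma}(n+1)=\sum_{i=0}^n\theta(n,i)\,\overline{\eta}(i+1)\qquad\text{and}\qquad \overline{\eta}(n+1)=\sum_{i=0}^n\Theta(n,i)\,\overline{\gamma}(i+1).$$
   Context: Shifted-gamma density with parameters $a,b>0$, $c\in\mathbb{R}$: $g(\vartheta;a,b,c)=\frac{1}{b^a\Gamma(a)}(\vartheta+c)^{a-1}\exp\left[-\frac{\vartheta+c}{b}\right]$ for $\vartheta>-c$ and $0$ otherwise; its moment generating function is $e^{-ct}/(1-bt)^a$. Negative binomial distribution with parameters $r>0$, $\lambda\ge 0$ on $\varpi=0,1,2,\ldots$: $nb(\varpi;r,\lambda)=\frac{\Gamma(r+\varpi)}{\Gamma(r)\Gamma(\varpi+1)}\left(\frac1{1+\lambda}\right)^r\left(\frac{\lambda}{1+\lambda}\right)^{\varpi}$; its moment generating function is $1/[1-\lambda(e^t-1)]^r$. The $n$th cumulant ($n\ge1$) of a distribution with moment generating function $M(t)$ is the coefficient of $t^n/n!$ in $\ln M(t)$. Let $\gamma(n)$, $\eta(n)$ be the $n$th cumulants of $g(\vartheta;a,b,c)$ and $nb(\varpi;r,\lambda)$ respectively. The two distributions are called matched if $\gamma(n)=\eta(n)$ for $n=1,2,3$. The scaled cumulants are $\overline{\gamma}(n)=\frac{2^n}{r}\gamma(n)$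 and $\overline{\eta}(n)=\frac{2^n}{r}\eta(n)$. Tanh numbers, for integers $n,m\ge0$: let $t(n,m)$, $T(n,m)$ be defined by $\sum_n t(n,m)\frac{v^n}{n!}=\frac{1}{m!}\arctan^m v$ and $\sum_n T(n,m)\frac{v^n}{n!}=\frac1{m!}\tan^m v$. Put $\theta(n,m)=(-1)^{(n-m)/2}t(n,m)$ and $\Theta(n,m)=(-1)^{(n-m)/2}T(n,m)$ when $n-m$ is even, and $\theta(n,m)=\Theta(n,m)=0$ when $n-m$ is odd. *)

theory Defs
  imports "HOL-Probability.Probability"
begin

text \<open>
  \<open>egf_coeff f n\<close> is the coefficient of \<open>v ^ n / n!\<close> in the power series expansion of \<open>f\<close>
  at 0, which is unique if it exists; otherwise the value is unspecified.
\<close>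
definition egf_coeff :: "(real \<Rightarrow> real) \<Rightarrow> nat \<Rightarrow> real" where
  "egf_coeff f n = fact n * fps_nth (THE F. f has_fps_expansion F) n"

lemma has_fps_expansion_zero_imp:
  fixes H :: "real fps"
  assumes "(\<lambda>_. 0) has_fps_expansion H"
  shows "fps_nth H n = 0"
  using assms
proof (induction n arbitrary: H)
  case 0
  then have "eval_fps H 0 = 0"
    by (auto simp: has_fps_expansion_def dest: eventually_nhds_x_imp_x)
  then show ?case
    by (simp add: eval_fps_at_0)
next
  case (Suc n)
  have "(deriv (\<lambda>_. 0 :: real)) has_fps_expansion fps_deriv H"
    using Suc.prems by (rule has_fps_expansion_deriv)
  then have "fps_nth (fps_deriv H) n = 0"
    by (intro Suc.IH) simp
  then show ?case
    by simp
qed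

lemma has_fps_expansion_unique_real:
  fixes F G :: "real fps"
  assumes "f has_fps_expansion F" "f has_fps_expansion G"
  shows "F = G"
proof (rule fps_ext)
  fix n
  have "(\<lambda>_. 0) has_fps_expansion (F - G)"
    using has_fps_expansion_diff[OF assms] by simp
  from has_fps_expansion_zero_imp[OF this, of n]
  show "fps_nth F n = fps_nth G n"
    by simp
qed

lemma egf_coeff_eqI:
  assumes "f has_fps_expansion F"
  shows "egf_coeff f n = fact n * fps_nth F n"
proof -
  have "(THE F. f has_fps_expansion F) = F"
    using assms by (blast intro: has_fps_expansion_unique_real)
  then show ?thesis
    by (simp add: egf_coeff_def)
qed

definition mgf :: "real measure \<Rightarrow> real \<Rightarrow> real" where
  "mgf M t = (LINT x|M. exp (t * x))"

text \<open>The \<open>n\<close>-th cumulant, for \<open>n \<ge> 1\<close>.\<close>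
definition cumulant :: "real measure \<Rightarrow> nat \<Rightarrow> real" where
  "cumulant M n = egf_coeff (\<lambda>t. ln (mgf M t)) n"

definition shifted_gamma_density :: "real \<Rightarrow> real \<Rightarrow> real \<Rightarrow> real \<Rightarrow> real" where
  "shifted_gamma_density a b c x =
     (if x > - c
      then 1 / (b powr a * Gamma a) * (x + c) powr (a - 1) * exp (- ((x + c) / b))
      else 0)"

definition shifted_gamma :: "real \<Rightarrow> real \<Rightarrow> real \<Rightarrow> real measure" where
  "shifted_gamma a b c = density lborel (\<lambda>x. ennreal (shifted_gamma_density a b c x))"

definition neg_binomial_mass :: "real \<Rightarrow> real \<Rightarrow> nat \<Rightarrow> real" where
  "neg_binomial_mass r l k =
     Gamma (r + real k) / (Gamma r * Gamma (real k + 1)) *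
       (1 / (1 + l)) powr r * (l / (1 + l)) ^ k"

text \<open>
  The library's \<open>neg_binomial_pmf\<close> only covers natural \<open>r\<close>. The distribution is transported
  from the natural numbers to the reals.
\<close>
definition neg_binomial :: "real \<Rightarrow> real \<Rightarrow> real measure" where
  "neg_binomial r l =
     distr (density (count_space (UNIV :: nat set)) (\<lambda>k. ennreal (neg_binomial_mass r l k)))
       borel real"

definition matched :: "real \<Rightarrow> real \<Rightarrow> real \<Rightarrow> real \<Rightarrow> real \<Rightarrow> bool" where
  "matched a b c r l \<longleftrightarrow>
     (\<forall>n\<in>{1, 2, 3}. cumulant (shifted_gamma a b c) n = cumulant (neg_binomial r l) n)"

definition gamma_scaled :: "real \<Rightarrow> real \<Rightarrow> real \<Rightarrow> real \<Rightarrow> nat \<Rightarrow> real" where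
  "gamma_scaled a b c r n = 2 ^ n / r * cumulant (shifted_gamma a b c) n"

definition eta_scaled :: "real \<Rightarrow> real \<Rightarrow> nat \<Rightarrow> real" where
  "eta_scaled r l n = 2 ^ n / r * cumulant (neg_binomial r l) n"

definition arctan_number :: "nat \<Rightarrow> nat \<Rightarrow> real" where
  "arctan_number n m = egf_coeff (\<lambda>v. arctan v ^ m / fact m) n"

definition tan_number :: "nat \<Rightarrow> nat \<Rightarrow> real" where
  "tan_number n m = egf_coeff (\<lambda>v. tan v ^ m / fact m) n"

definition theta :: "nat \<Rightarrow> nat \<Rightarrow> real" where
  "theta n m =
     (if even (int n - int m)
      then (- 1) powi ((int n - int m) div 2) * arctan_number n m else 0)"

definition Theta :: "nat \<Rightarrow> nat \<Rightarrow> real" where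
  "Theta n m =
     (if even (int n - int m)
      then (- 1) powi ((int n - int m) div 2) * tan_number n m else 0)"

end

theory Submission
  imports Defs
begin

text \<open>
  For \<open>n \<ge> 0\<close> let \<open>G(v)\<close> and \<open>H(s)\<close> be the exponential generating functions of the scaled cumulants
  \<open>\<gamma>(n + 1)\<close> and \<open>\<eta>(n + 1)\<close>. They are rescaled derivatives of the cumulant generating functions
  \<open>- c t - a ln (1 - b t)\<close> and \<open>- r ln (1 + l - l exp t)\<close>. Matching the first three cumulants
  forces \<open>2 b = 1 + 2 l\<close>, and with \<open>x = 1 + 2 l\<close> one finds
  \<open>1 + G(v) = (x - v) / (1 - x v)\<close>. On the other side \<open>V = 1 + H\<close> solves the Riccati equation
  \<open>V' = V\<^sup>2 - 1\<close> with \<open>V(0) = x\<close>, whose solution is the addition formula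
  \<open>V(s) = (x - tanh s) / (1 - x tanh s)\<close>. Hence \<open>H(s) = G(tanh s)\<close>, and by inversion
  \<open>G(v) = H(artanh v)\<close>.
  
  On coefficients, composition with \<open>tanh\<close> is multiplication by the matrix with entries
  \<open>n! / m! * [v^n] tanh^m v\<close>, and similarly for \<open>artanh\<close>. These entries are \<open>\<Theta>(n,m)\<close> and
  \<open>\<theta>(n,m)\<close>, because the signs in their definition carry out the substitution of the imaginary unit that
  turns \<open>tan\<close> and \<open>arctan\<close> into \<open>tanh\<close> and \<open>artanh\<close>.
  
  The key lemmas are \<open>theta_eq\<close> and \<open>Theta_eq\<close> for the matrices, \<open>scaled_gamma_fps_moebius\<close> and
  \<open>scaled_neg_binomial_fps_riccati\<close> for the two generating functions, and \<open>riccati_compose_tanh\<close>, which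
  connects them. All of these are identities of formal power series; analysis is needed only for the moment
  generating functions and for the passage from functions to their series.
\<close>

section \<open>Power series of antiderivatives\<close>

text \<open>
  This gives the expansions of \<open>arctan\<close> and of the logarithms of both moment generating functions
  from those of their derivatives, which are rational expressions in the variable or its exponential.
\<close>
lemma has_fps_expansion_antiderivative:
  fixes f f' :: "real \<Rightarrow> real"
  assumes f': "f' has_fps_expansion F"
    and deriv: "eventually (\<lambda>x. (f has_field_derivative f' x) (at x)) (nhds 0)"
  shows "f has_fps_expansion fps_integral F (f 0)"
proof -
  define G where "G = fps_integral F (f 0)"
  have G': "fps_deriv G = F"
    by (simp add: G_def fps_deriv_fps_integral)
  have rad: "fps_conv_radius F \<le> fps_conv_radius G"
    unfolding fps_conv_radius_def
  proof (rule conv_radius_geI_ex)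
    fix \<rho> :: real
    assume \<rho>: "\<rho> > 0" "ereal \<rho> < conv_radius (fps_nth F)"
    have "summable (\<lambda>n. norm (fps_nth F n * \<rho> ^ n))"
      using \<rho> by (intro abs_summable_in_conv_radius) auto
    then have "summable (\<lambda>n. \<rho> * norm (fps_nth F n * \<rho> ^ n))"
      by (rule summable_mult)
    then have "summable (\<lambda>n. fps_nth G (Suc n) * \<rho> ^ Suc n)"
    proof (rule summable_comparison_test'[where N = 0])
      fix n :: nat
      have "inverse (real (Suc n)) \<le> 1"
        by (simp add: inverse_le_1_iff)
      then have "inverse (real (Suc n)) * (\<rho> * (\<bar>fps_nth F n\<bar> * \<rho> ^ n)) \<le> 1 * (\<rho> * (\<bar>fps_nth F n\<bar> * \<rho> ^ n))"
        using \<rho> by (intro mult_right_mono) auto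
      then show "norm (fps_nth G (Suc n) * \<rho> ^ Suc n) \<le> \<rho> * norm (fps_nth F n * \<rho> ^ n)"
        using \<rho> by (simp add: G_def fps_integral_def abs_mult mult_ac del: of_nat_Suc)
    qed
    then have "summable (\<lambda>n. fps_nth G n * \<rho> ^ n)"
      by (subst (asm) summable_Suc_iff)
    then show "\<exists>z. norm z = \<rho> \<and> summable (\<lambda>n. fps_nth G n * z ^ n)"
      using \<rho> by (intro exI[of _ \<rho>]) auto
  qed
  have "fps_conv_radius F > 0"
    using f' by (simp add: has_fps_expansion_def)
  then have "eventually (\<lambda>z. z \<in> eball 0 (fps_conv_radius F)) (nhds (0::real))"
    by (intro eventually_nhds_in_open) (auto simp: zero_ereal_def)
  moreover have "eventually (\<lambda>z. eval_fps F z = f' z) (nhds 0)"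
    using f' by (simp add: has_fps_expansion_def)
  ultimately have "eventually (\<lambda>x. ((\<lambda>x. eval_fps G x - f x) has_field_derivative 0) (at x)) (nhds 0)"
    using deriv
  proof eventually_elim
    case (elim x)
    have "(eval_fps G has_field_derivative eval_fps (fps_deriv G) x) (at x)"
      using elim(1) rad by (intro has_field_derivative_eval_fps) (auto simp: eball_def)
    from DERIV_diff[OF this elim(3)] show ?case
      using elim(2) by (simp add: G')
  qed
  then obtain e where e: "e > 0"
      "\<And>x. dist x 0 < e \<Longrightarrow> ((\<lambda>x. eval_fps G x - f x) has_field_derivative 0) (at x)"
    unfolding eventually_nhds_metric by blast
  \<comment> \<open>The sum of the integrated series and \<open>f\<close> have the same derivative and the same value at 0.\<close>
  have "\<exists>k. \<forall>x\<in>ball 0 e. eval_fps G x - f x = k"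
    by (rule has_field_derivative_zero_constant)
       (use e(2) in \<open>auto simp: dist_commute intro: has_field_derivative_at_within\<close>)
  then obtain k where k: "\<And>x. x \<in> ball 0 e \<Longrightarrow> eval_fps G x - f x = k"
    by blast
  have "k = 0"
    using k[of 0] e(1) by (simp add: eval_fps_at_0 G_def)
  then have "eventually (\<lambda>x. eval_fps G x = f x) (nhds 0)"
    using k e(1) by (auto simp: eventually_nhds_metric dist_commute)
  then show ?thesis
    using rad \<open>fps_conv_radius F > 0\<close> by (auto simp: has_fps_expansion_def G_def)
qed

section \<open>Twisting the signs of even and odd series\<close>
definition fps_parity :: "int \<Rightarrow> real fps \<Rightarrow> bool" where
  "fps_parity k F \<longleftrightarrow> (\<forall>n. odd (int n - k) \<longrightarrow> fps_nth F n = 0)"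

text \<open>
  Over the complex numbers this is \<open>F(v) \<mapsto> i ^ k * F(v / i)\<close> on series of parity \<open>k\<close>; on odd series
  and for \<open>k = 1\<close> it turns \<open>arctan\<close> and \<open>tan\<close> into \<open>artanh\<close> and \<open>tanh\<close>. Writing the substitution as
  a sign change keeps all series real and matches the signs in \<^const>\<open>theta\<close> and \<^const>\<open>Theta\<close>
  literally.
\<close>
definition sign_twist :: "int \<Rightarrow> real fps \<Rightarrow> real fps" where
  "sign_twist k F = Abs_fps (\<lambda>n. if even (int n - k)
     then (- 1) powi ((int n - k) div 2) * fps_nth F n else 0)"

lemma fps_parity_mult:
  assumes "fps_parity j F" "fps_parity k G"
  shows "fps_parity (j + k) (F * G)"
  unfolding fps_parity_def
proof (intro allI impI)
  fix n
  assume n: "odd (int n - (j + k))"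
  show "fps_nth (F * G) n = 0"
    unfolding fps_mult_nth
  proof (rule sum.neutral, rule ballI)
    fix i assume "i \<in> {0..n}"
    then have "int (n - i) = int n - int i" by auto
    then have "odd (int i - j) \<or> odd (int (n - i) - k)" using n by auto
    then show "fps_nth F i * fps_nth G (n - i) = 0"
      using assms by (auto simp: fps_parity_def)
  qed
qed

text \<open>
  The index \<open>k\<close> acts as a grading: in the Cauchy product only pairs of coefficients of the right
  parities survive, and for those the two exponents of \<open>- 1\<close> add up.
\<close>
lemma sign_twist_mult:
  assumes "fps_parity j F" "fps_parity k G"
  shows "sign_twist (j + k) (F * G) = sign_twist j F * sign_twist k G"
proof (rule fps_ext)
  fix n
  have "(if even (int n - (j + k)) then (- 1) powi ((int n - (j + k)) div 2) *
           (fps_nth F i * fps_nth G (n - i)) else 0) =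
        fps_nth (sign_twist j F) i * fps_nth (sign_twist k G) (n - i)"
    if "i \<in> {0..n}" for i
  proof (cases "even (int i - j) \<and> even (int (n - i) - k)")
    case True
    then obtain p q where p: "int i - j = 2 * p" and q: "int (n - i) - k = 2 * q"
      by (elim conjE evenE)
    have "int n - (j + k) = 2 * (p + q)"
      using p q that by auto
    then have "fps_nth (sign_twist j F) i = (- 1) powi p * fps_nth F i"
      "fps_nth (sign_twist k G) (n - i) = (- 1) powi q * fps_nth G (n - i)"
      "even (int n - (j + k))" "(int n - (j + k)) div 2 = p + q"
      unfolding sign_twist_def fps_nth_Abs_fps p q by simp_all
    then show ?thesis
      by (simp add: power_int_add)
  next
    case False
    then have "fps_nth F i * fps_nth G (n - i) = 0"
      using assms by (auto simp: fps_parity_def)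
    with False show ?thesis
      by (auto simp: sign_twist_def)
  qed
  note term_eq = this
  have "fps_nth (sign_twist (j + k) (F * G)) n =
        (\<Sum>i=0..n. if even (int n - (j + k)) then (- 1) powi ((int n - (j + k)) div 2) *
           (fps_nth F i * fps_nth G (n - i)) else 0)"
    by (cases "even (int n - (j + k))")
       (simp_all only: sign_twist_def fps_nth_Abs_fps fps_mult_nth sum_distrib_left
          if_True if_False sum.neutral_const)
  also have "\<dots> = fps_nth (sign_twist j F * sign_twist k G) n"
    unfolding fps_mult_nth by (intro sum.cong refl term_eq)
  finally show "fps_nth (sign_twist (j + k) (F * G)) n = fps_nth (sign_twist j F * sign_twist k G) n" .
qed

lemma fps_parity_power:
  assumes "fps_parity 1 F"
  shows "fps_parity (int m) (F ^ m)"
proof (induction m)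
  case (Suc m)
  show ?case
    using fps_parity_mult[OF assms Suc] by simp
qed (simp add: fps_parity_def)

lemma sign_twist_power:
  assumes "fps_parity 1 F"
  shows "sign_twist (int m) (F ^ m) = sign_twist 1 F ^ m"
proof (induction m)
  case 0
  show ?case
    by (auto simp: sign_twist_def fps_eq_iff)
next
  case (Suc m)
  show ?case
    using sign_twist_mult[OF assms fps_parity_power[OF assms], of m] Suc by simp
qed

lemma sign_twist_deriv: "sign_twist k (fps_deriv F) = fps_deriv (sign_twist (k + 1) F)"
  by (simp add: fps_eq_iff sign_twist_def)

lemma sign_twist_add: "sign_twist k (F + G) = sign_twist k F + sign_twist k G"
  by (simp add: fps_eq_iff sign_twist_def algebra_simps)

lemma sign_twist_0_1 [simp]: "sign_twist 0 1 = 1"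
  by (simp add: fps_eq_iff sign_twist_def)

text \<open>
  The square of an odd series is naturally twisted with \<open>k = 2\<close>. Going down to \<open>k = 0\<close> costs a sign,
  which is what turns \<open>1 + tan\<^sup>2\<close> into \<open>1 - tanh\<^sup>2\<close> and \<open>1 + v\<^sup>2\<close> into \<open>1 - v\<^sup>2\<close>.
\<close>
lemma sign_twist_0_square:
  assumes "fps_parity 1 F"
  shows "sign_twist 0 (F\<^sup>2) = - (sign_twist 1 F)\<^sup>2"
proof -
  have "sign_twist 0 (F\<^sup>2) = - sign_twist 2 (F\<^sup>2)"
    by (auto simp: fps_eq_iff sign_twist_def power_int_diff elim!: evenE)
  then show ?thesis
    using sign_twist_power[OF assms, of 2] by simp
qed

text \<open>
  Evenness as invariance under \<open>v \<mapsto> - v\<close>, a substitution that commutes with inversion.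
\<close>
lemma fps_parity_even_iff: "fps_parity 0 F \<longleftrightarrow> F oo (fps_const (-1) * fps_X) = F"
  by (auto simp: fps_parity_def fps_eq_iff minus_one_power_iff)

lemma fps_parity_inverse:
  assumes "fps_parity 0 F" "fps_nth F 0 \<noteq> 0"
  shows "fps_parity 0 (inverse F)"
  using assms fps_inverse_compose[of "fps_const (-1) * fps_X" F]
  by (simp add: fps_parity_even_iff)

section \<open>The series of tanh and artanh\<close>
lemma fps_parity_1_plus_X2: "fps_parity 0 (1 + fps_X\<^sup>2)"
  by (auto simp: fps_parity_def fps_X_power_nth)

lemma fps_parity_tan: "fps_parity 1 (fps_tan 1)"
proof -
  have "fps_parity 0 (fps_cos 1)" "fps_parity 1 (fps_sin 1)"
    by (auto simp: fps_parity_def fps_cos_def fps_sin_def)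
  then have "fps_parity (1 + 0) (fps_sin 1 * inverse (fps_cos 1))"
    by (intro fps_parity_mult fps_parity_inverse) (auto simp: fps_cos_def)
  then show ?thesis
    by (simp add: fps_tan_def fps_divide_unit fps_cos_def)
qed

lemma fps_tan_ode: "fps_deriv (fps_tan (1::real)) = 1 + (fps_tan 1)\<^sup>2"
proof -
  define C where "C = fps_cos (1::real)"
  have C0: "fps_nth C 0 = 1" by (simp add: C_def fps_cos_def)
  then have nz: "C\<^sup>2 \<noteq> 0" by auto
  have unit: "C * inverse C = 1"
    using C0 by (simp add: inverse_mult_eq_1')
  have T: "C * fps_tan 1 = fps_sin 1"
    using C0 unit by (simp add: fps_tan_def C_def fps_divide_unit mult_ac)
  have "C\<^sup>2 * (1 + (fps_tan 1)\<^sup>2) = 1"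
    using fps_sin_cos_sum_of_squares[of "1::real"]
    by (simp add: distrib_left T[symmetric] power_mult_distrib C_def)
  moreover have "C\<^sup>2 * fps_deriv (fps_tan 1) = 1"
    using C0 unit by (simp add: fps_tan_deriv C_def[symmetric] fps_divide_unit power2_eq_square inverse_mult_eq_1')
  ultimately show ?thesis
    using nz by (metis mult_left_cancel)
qed

definition fps_arctan :: "real fps" where
  "fps_arctan = fps_integral0 (inverse (1 + fps_X\<^sup>2))"

text \<open>
  That this and the next series are those of the hyperbolic functions is expressed by the
  differential equations \<open>fps_tanh_ode\<close> and \<open>fps_artanh_ode\<close> below.
\<close>
definition fps_tanh :: "real fps" where
  "fps_tanh = sign_twist 1 (fps_tan 1)"

definition fps_artanh :: "real fps" where
  "fps_artanh = sign_twist 1 fps_arctan"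

lemma has_fps_expansion_arctan: "arctan has_fps_expansion fps_arctan"
proof -
  have "(\<lambda>x. inverse (1 + x\<^sup>2)) has_fps_expansion inverse (1 + fps_X\<^sup>2 :: real fps)"
    by (intro fps_expansion_intros) auto
  from has_fps_expansion_antiderivative[OF this, of arctan] show ?thesis
    by (simp add: fps_arctan_def DERIV_arctan)
qed

lemma fps_parity_arctan: "fps_parity 1 fps_arctan"
  unfolding fps_parity_def
proof (intro allI impI)
  fix n :: nat
  assume n: "odd (int n - 1)"
  have "fps_parity 0 (inverse (1 + fps_X\<^sup>2))"
    by (intro fps_parity_inverse fps_parity_1_plus_X2) auto
  with n show "fps_nth fps_arctan n = 0"
    by (cases n) (auto simp: fps_arctan_def fps_integral_def fps_parity_def)
qed

lemma fps_tanh_0 [simp]: "fps_nth fps_tanh 0 = 0"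
  by (simp add: fps_tanh_def sign_twist_def)

lemma fps_artanh_0 [simp]: "fps_nth fps_artanh 0 = 0"
  by (simp add: fps_artanh_def sign_twist_def)

lemma fps_tanh_ode: "fps_deriv fps_tanh = 1 - fps_tanh\<^sup>2"
  using sign_twist_deriv[of 0 "fps_tan 1"] fps_parity_tan
  by (simp add: fps_tanh_def fps_tan_ode sign_twist_add sign_twist_0_square)

lemma fps_artanh_ode: "(1 - fps_X\<^sup>2) * fps_deriv fps_artanh = 1"
proof -
  have d: "fps_deriv fps_arctan = inverse (1 + fps_X\<^sup>2)"
    by (simp add: fps_arctan_def fps_deriv_fps_integral)
  have "sign_twist 0 (1 + fps_X\<^sup>2) * sign_twist 0 (fps_deriv fps_arctan) = sign_twist (0 + 0) ((1 + fps_X\<^sup>2) * fps_deriv fps_arctan)"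
    unfolding d
    by (intro sign_twist_mult [symmetric] fps_parity_inverse fps_parity_1_plus_X2) auto
  also have "(1 + fps_X\<^sup>2) * fps_deriv fps_arctan = 1"
    unfolding d by (rule inverse_mult_eq_1') auto
  finally have "sign_twist 0 (1 + fps_X\<^sup>2) * fps_deriv fps_artanh = 1"
    by (simp add: sign_twist_deriv fps_artanh_def)
  moreover have "sign_twist 1 fps_X = fps_X" "fps_parity 1 fps_X"
    by (auto simp: fps_eq_iff sign_twist_def fps_parity_def fps_X_def)
  ultimately show ?thesis
    by (simp add: sign_twist_add sign_twist_0_square)
qed

text \<open>
  The numbers \<open>\<theta>(n,m)\<close> and \<open>\<Theta>(n,m)\<close> are, by \<open>sign_twist_power\<close>, the coefficients of the powers of one
  twisted series, that is, the entries of its composition matrix.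
\<close>
lemma egf_coeff_twisted_power:
  assumes "f has_fps_expansion F" "fps_parity 1 F"
  shows "(if even (int n - int m)
           then (- 1) powi ((int n - int m) div 2) * egf_coeff (\<lambda>v. f v ^ m / fact m) n else 0) =
         fact n / fact m * fps_nth (sign_twist 1 F ^ m) n"
proof -
  have "(\<lambda>v. f v ^ m * (1 / fact m)) has_fps_expansion F ^ m * fps_const (1 / fact m)"
  proof (intro fps_expansion_intros)
    show "(\<lambda>v. f v ^ m) has_fps_expansion F ^ m"
      by (induction m) (auto intro!: fps_expansion_intros assms)
  qed
  then have "egf_coeff (\<lambda>v. f v ^ m / fact m) n = fact n / fact m * fps_nth (F ^ m) n"
    by (subst egf_coeff_eqI[where F = "F ^ m * fps_const (1 / fact m)"])
       (simp_all add: fps_mult_right_const_nth)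
  then show ?thesis
    by (simp add: sign_twist_power[OF assms(2), symmetric]) (simp add: sign_twist_def)
qed

lemma theta_eq: "theta n m = fact n / fact m * fps_nth (fps_artanh ^ m) n"
  unfolding theta_def arctan_number_def fps_artanh_def
  by (rule egf_coeff_twisted_power[OF has_fps_expansion_arctan fps_parity_arctan])

lemma Theta_eq: "Theta n m = fact n / fact m * fps_nth (fps_tanh ^ m) n"
  unfolding Theta_def tan_number_def fps_tanh_def
  by (rule egf_coeff_twisted_power[OF has_fps_expansion_tan' fps_parity_tan])

text \<open>
  By the two differential equations and the chain rule, the composition has derivative 1.
\<close>
lemma fps_artanh_compose_tanh: "fps_artanh oo fps_tanh = fps_X"
proof -
  have "fps_deriv (fps_artanh oo fps_tanh) = (1 - fps_tanh\<^sup>2) * (fps_deriv fps_artanh oo fps_tanh)"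
    by (simp add: fps_compose_deriv fps_tanh_ode mult_ac)
  also have "\<dots> = ((1 - fps_X\<^sup>2) * fps_deriv fps_artanh) oo fps_tanh"
    by (simp add: fps_compose_mult_distrib fps_compose_sub_distrib
        flip: fps_compose_power)
  also have "\<dots> = fps_deriv fps_X"
    by (simp add: fps_artanh_ode)
  finally show ?thesis
    by (subst (asm) fps_deriv_eq_iff) simp
qed

text \<open>
  A left inverse under composition is also a right inverse, because composition with \<open>tanh\<close>,
  whose linear coefficient is nonzero, is injective.
\<close>
lemma fps_tanh_compose_artanh: "fps_tanh oo fps_artanh = fps_X"
proof -
  have "fps_nth fps_tanh 1 = fps_nth (fps_deriv fps_tanh) 0"
    by simp
  also have "\<dots> = 1"
    by (simp add: fps_tanh_ode)
  finally have "fps_nth fps_tanh 1 \<noteq> 0"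
    by simp
  moreover have "(fps_tanh oo fps_artanh) oo fps_tanh = fps_X oo fps_tanh"
    by (simp add: fps_compose_assoc[symmetric] fps_artanh_compose_tanh)
  ultimately show ?thesis
    using fps_compose_inj_right fps_tanh_0 by blast
qed

section \<open>A Riccati equation solved by a Moebius function of tanh\<close>
lemma fps_linear_ode_zero:
  fixes D :: "real fps"
  assumes ode: "fps_deriv D = C * D" and init: "fps_nth D 0 = 0"
  shows "D = 0"
proof (rule fps_ext)
  fix n
  show "fps_nth D n = fps_nth 0 n"
  proof (induction n rule: less_induct)
    case (less n)
    show ?case
    proof (cases n)
      case (Suc k)
      have "of_nat n * fps_nth D n = fps_nth (C * D) k"
        using Suc by (simp flip: ode)
      also have "\<dots> = 0"
        unfolding fps_mult_nth using less Suc by (intro sum.neutral) auto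
      finally show ?thesis
        using Suc by simp
    qed (use init in simp)
  qed
qed

text \<open>
  The series \<open>U\<close> is that of \<open>(x - v) / (1 - x * v)\<close>, and \<open>(x - tanh s) / (1 - x * tanh s)\<close> is the
  solution of \<open>V' = V\<^sup>2 - 1\<close> with \<open>V(0) = x\<close>. Instead of uniqueness for the nonlinear
  equation, the proof uses that the defect \<open>D\<close> of the cleared denominator solves a linear one.
\<close>
lemma riccati_compose_tanh:
  fixes U V :: "real fps" and x :: real
  assumes U: "(1 - fps_const x * fps_X) * U = fps_const x - fps_X"
    and V: "fps_deriv V = V\<^sup>2 - 1" "fps_nth V 0 = x"
  shows "V = U oo fps_tanh"
proof -
  let ?T = fps_tanh
  define D where "D = (1 - fps_const x * ?T) * V - (fps_const x - ?T)"
  have "fps_deriv D = (V - ?T) * D"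
    by (simp add: D_def V fps_tanh_ode power2_eq_square algebra_simps)
  then have "D = 0"
    by (rule fps_linear_ode_zero) (simp add: D_def V)
  then have "(1 - fps_const x * ?T) * V = fps_const x - ?T"
    by (simp add: D_def)
  also have "\<dots> = ((1 - fps_const x * fps_X) * U) oo ?T"
    by (simp add: U fps_compose_sub_distrib)
  also have "\<dots> = (1 - fps_const x * ?T) * (U oo ?T)"
    by (simp add: fps_compose_mult_distrib fps_compose_sub_distrib)
  finally have "(1 - fps_const x * ?T) * V = (1 - fps_const x * ?T) * (U oo ?T)" .
  moreover have "fps_nth (1 - fps_const x * ?T) 0 \<noteq> 0"
    by simp
  then have "1 - fps_const x * ?T \<noteq> 0"
    by fastforce
  ultimately show ?thesis
    by simp
qed

section \<open>Cumulants of the two distributions\<close>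

text \<open>
  The series of the derivative of the cumulant generating function \<open>ln (mgf M t)\<close>. The shift by one
  drops the constant term, which is not a cumulant, and agrees with the index \<open>n + 1\<close> of the theorem.
\<close>
definition cumulant_fps :: "real measure \<Rightarrow> real fps" where
  "cumulant_fps M = Abs_fps (\<lambda>n. cumulant M (n + 1) / fact n)"

lemma cumulant_fpsI:
  assumes mgf: "eventually (\<lambda>t. ln (mgf M t) = K t) (nhds 0)"
    and K: "eventually (\<lambda>t. (K has_field_derivative K' t) (at t)) (nhds 0)"
    and K': "K' has_fps_expansion F"
  shows "cumulant_fps M = F"
proof -
  have "K has_fps_expansion fps_integral F (K 0)"
    using has_fps_expansion_antiderivative[OF K' K] .
  then have "(\<lambda>t. ln (mgf M t)) has_fps_expansion fps_integral F (K 0)"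
    unfolding has_fps_expansion_def using mgf by (auto elim: eventually_elim2)
  then show ?thesis
    by (simp add: fps_eq_iff cumulant_fps_def cumulant_def egf_coeff_eqI fps_integral_def
        del: of_nat_Suc)
qed

lemma Gamma_integral_lborel:
  assumes "a > 0"
  shows "(LINT y|lborel. indicator {0..} y * y powr (a - 1) / exp y :: real) = Gamma a"
proof -
  have "(LINT y|lborel. indicator {0..} y * y powr (a - 1) / exp y :: real) =
        enn2real (\<integral>\<^sup>+ y. ennreal (indicator {0..} y * y powr (a - 1) / exp y) \<partial>lborel)"
    by (rule integral_eq_nn_integral) auto
  also have "\<dots> = Gamma a"
    using assms by (simp flip: Gamma_conv_nn_integral_real)
  finally show ?thesis .
qed

text \<open>
  The affine substitution \<open>x = - c + s * y\<close> with \<open>s = b / (1 - b * t)\<close> turns the exponent into \<open>- y\<close> and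
  leaves Euler's integral for \<open>Gamma a\<close>.
\<close>
lemma mgf_shifted_gamma:
  assumes a: "a > 0" and b: "b > 0" and t: "b * t < 1"
  shows "mgf (shifted_gamma a b c) t = exp (- c * t) * (1 - b * t) powr (- a)"
proof -
  define s where "s = b / (1 - b * t)"
  have s: "s > 0" "s / b = 1 + t * s"
    using b t by (simp_all add: s_def field_simps)
  have G: "Gamma a > 0"
    using a by (rule Gamma_real_pos)
  have [measurable]: "shifted_gamma_density a b c \<in> borel_measurable borel"
    unfolding shifted_gamma_density_def[abs_def] by measurable
  have "mgf (shifted_gamma a b c) t = (LINT x|lborel. shifted_gamma_density a b c x * exp (t * x))"
    unfolding mgf_def shifted_gamma_def
    by (subst integral_density)
       (use G in \<open>auto simp: shifted_gamma_density_def intro!: AE_I2\<close>)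
  also have "\<dots> = s * (LINT y|lborel. shifted_gamma_density a b c (- c + s * y) * exp (t * (- c + s * y)))"
    using lborel_integral_real_affine[of s "\<lambda>x. shifted_gamma_density a b c x * exp (t * x)" "- c"] s
    by simp
  also have "(\<lambda>y. shifted_gamma_density a b c (- c + s * y) * exp (t * (- c + s * y))) =
             (\<lambda>y. exp (- c * t) * s powr (a - 1) / (b powr a * Gamma a) * (indicator {0..} y * y powr (a - 1) / exp y))"
  proof
    fix y :: real
    consider "y > 0" | "y = 0" | "y < 0" by linarith
    then show "shifted_gamma_density a b c (- c + s * y) * exp (t * (- c + s * y)) =
       exp (- c * t) * s powr (a - 1) / (b powr a * Gamma a) * (indicator {0..} y * y powr (a - 1) / exp y)"
    proof cases
      case 1
      have "s * y / b = y + t * s * y"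
        using s(2) by (simp add: algebra_simps flip: times_divide_eq_left)
      then have "exp (- (s * y / b)) * exp (t * (- c + s * y)) = exp (- c * t) * exp (- y)"
        by (simp add: algebra_simps flip: exp_add)
      moreover have "(s * y) powr (a - 1) = s powr (a - 1) * y powr (a - 1)"
        using s 1 by (simp add: powr_mult)
      ultimately show ?thesis
        using 1 s by (simp add: shifted_gamma_density_def exp_minus field_simps)
    next
      case 3
      then show ?thesis
        using s mult_pos_neg[of s y] by (simp add: shifted_gamma_density_def)
    qed (simp add: shifted_gamma_density_def)
  qed
  also have "(LINT y|lborel. exp (- c * t) * s powr (a - 1) / (b powr a * Gamma a) * (indicator {0..} y * y powr (a - 1) / exp y)) =
      exp (- c * t) * s powr (a - 1) / (b powr a * Gamma a) * Gamma a"
    using a by (subst integral_mult_right_zero) (simp add: Gamma_integral_lborel)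
  also have "s * \<dots> = exp (- c * t) * (s powr a / b powr a)"
    using s G by (simp add: powr_diff)
  also have "s powr a / b powr a = (1 - b * t) powr (- a)"
    using b t by (simp add: s_def powr_divide powr_minus_divide)
  finally show ?thesis .
qed

lemma cumulant_fps_shifted_gamma:
  assumes a: "a > 0" and b: "b > 0"
  shows "cumulant_fps (shifted_gamma a b c) =
         fps_const (- c) + fps_const (a * b) * inverse (1 - fps_const b * fps_X)"
proof (rule cumulant_fpsI)
  have "eventually (\<lambda>t. t < 1 / b) (nhds 0)"
    using b by (intro eventually_nhds_in_open[of "{..<1/b}", simplified]) auto
  then have ev: "eventually (\<lambda>t. b * t < 1) (nhds 0)"
    by eventually_elim (use b in \<open>simp add: field_simps\<close>)
  then show "eventually (\<lambda>t. ln (mgf (shifted_gamma a b c) t) = - c * t - a * ln (1 - b * t)) (nhds 0)"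
    by eventually_elim (use a b in \<open>simp add: mgf_shifted_gamma ln_mult ln_powr\<close>)
  from ev show "eventually (\<lambda>t. ((\<lambda>t. - c * t - a * ln (1 - b * t)) has_field_derivative
                  (- c + a * b * inverse (1 - b * t))) (at t)) (nhds 0)"
    by eventually_elim (auto intro!: derivative_eq_intros simp: field_simps)
  show "(\<lambda>t. - c + a * b * inverse (1 - b * t)) has_fps_expansion
        fps_const (- c) + fps_const (a * b) * inverse (1 - fps_const b * fps_X)"
    by (intro fps_expansion_intros) auto
qed

text \<open>
  This is what makes the distribution negative binomial: up to a factor, the masses are the terms of the
  binomial series with exponent \<open>- r\<close>.
\<close>
lemma neg_binomial_mass_eq:
  assumes r: "r > 0" and l: "l \<ge> 0"
  shows "neg_binomial_mass r l k =
         (1 / (1 + l)) powr r * (((- r) gchoose k) * (- (l / (1 + l))) ^ k)"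
proof -
  have "r \<notin> \<int>\<^sub>\<le>\<^sub>0"
    using r by (auto elim!: nonpos_Ints_cases)
  then have "pochhammer r k = Gamma (r + real k) / Gamma r"
    by (rule pochhammer_Gamma)
  moreover have "Gamma (real k + 1) = fact k"
    by (simp add: Gamma_fact add.commute)
  moreover have "((- r) gchoose k) * (- (l / (1 + l))) ^ k = pochhammer r k / fact k * (l / (1 + l)) ^ k"
  proof -
    have "(- (l / (1 + l))) ^ k = (- 1) ^ k * (l / (1 + l)) ^ k"
      by (rule power_minus)
    moreover have "(- r) gchoose k = (- 1) ^ k * pochhammer r k / fact k"
      by (simp add: gbinomial_pochhammer)
    moreover have "(- 1 :: real) ^ k * (- 1) ^ k = 1"
      by (simp flip: power_mult_distrib)
    ultimately show ?thesis
      by simp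
  qed
  ultimately show ?thesis
    unfolding neg_binomial_mass_def by (simp only:) (simp add: mult_ac)
qed

lemma mgf_neg_binomial:
  assumes r: "r > 0" and l: "l \<ge> 0" and t: "l * exp t < 1 + l"
  shows "mgf (neg_binomial r l) t = (1 + l - l * exp t) powr (- r)"
proof -
  define z where "z = l / (1 + l) * exp t"
  have z: "0 \<le> z" "z < 1"
    using l t by (simp_all add: z_def field_simps)
  have nonneg: "neg_binomial_mass r l k \<ge> 0" for k
    using r l unfolding neg_binomial_mass_def
    by (intro mult_nonneg_nonneg divide_nonneg_nonneg zero_le_power less_imp_le[OF Gamma_real_pos]) auto
  have term_eq: "neg_binomial_mass r l k * exp (t * real k) =
      (1 / (1 + l)) powr r * (((- r) gchoose k) * (- z) ^ k)" for k
  proof -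
    have "(- z) ^ k = (- (l / (1 + l))) ^ k * exp (t * real k)"
      by (simp add: z_def exp_of_nat2_mult flip: power_mult_distrib)
    then show ?thesis
      using r l by (simp add: neg_binomial_mass_eq)
  qed
  have "(\<lambda>k. ((- r) gchoose k) * (- z) ^ k) sums (1 + (- z)) powr (- r)"
    using z by (intro gen_binomial_real) auto
  then have sums: "(\<lambda>k. neg_binomial_mass r l k * exp (t * real k)) sums
      ((1 / (1 + l)) powr r * (1 - z) powr (- r))"
    unfolding term_eq by (intro sums_mult) simp
  have "mgf (neg_binomial r l) t =
        (LINT k|density (count_space UNIV) (\<lambda>k. ennreal (neg_binomial_mass r l k)). exp (t * real k))"
    unfolding mgf_def neg_binomial_def by (subst integral_distr) auto
  also have "\<dots> = (LINT k|count_space UNIV. neg_binomial_mass r l k * exp (t * real k))"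
    by (subst integral_density) (auto simp: nonneg)
  also have "\<dots> = (\<Sum>k. neg_binomial_mass r l k * exp (t * real k))"
    using sums nonneg by (intro integral_count_space_nat) (auto simp: integrable_count_space_nat_iff sums_iff)
  also have "\<dots> = (1 / (1 + l)) powr r * (1 - z) powr (- r)"
    using sums by (simp add: sums_iff)
  also have "\<dots> = ((1 + l) * (1 - z)) powr (- r)"
    using l z by (simp add: powr_mult powr_divide powr_minus_divide)
  also have "(1 + l) * (1 - z) = 1 + l - l * exp t"
    using l by (simp add: z_def field_simps)
  finally show ?thesis .
qed

lemma cumulant_fps_neg_binomial:
  assumes r: "r > 0" and l: "l \<ge> 0"
  shows "cumulant_fps (neg_binomial r l) =
         fps_const (r * l) * fps_exp 1 * inverse (fps_const (1 + l) - fps_const l * fps_exp 1)"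
proof (rule cumulant_fpsI)
  have "isCont (\<lambda>t. l * exp t) 0"
    by (intro continuous_intros)
  then have "((\<lambda>t. l * exp t) \<longlongrightarrow> l) (nhds 0)"
    by (simp add: isCont_def tendsto_nhds_iff)
  then have ev: "eventually (\<lambda>t. l * exp t < 1 + l) (nhds 0)"
    by (rule order_tendstoD) auto
  then show "eventually (\<lambda>t. ln (mgf (neg_binomial r l) t) = - r * ln (1 + l - l * exp t)) (nhds 0)"
    by eventually_elim (use r l in \<open>simp add: mgf_neg_binomial ln_powr\<close>)
  from ev show "eventually (\<lambda>t. ((\<lambda>t. - r * ln (1 + l - l * exp t)) has_field_derivative
                  (r * l * exp t * inverse (1 + l - l * exp t))) (at t)) (nhds 0)"
    by eventually_elim (auto intro!: derivative_eq_intros simp: field_simps)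
  show "(\<lambda>t. r * l * exp t * inverse (1 + l - l * exp t)) has_fps_expansion
      fps_const (r * l) * fps_exp 1 * inverse (fps_const (1 + l) - fps_const l * fps_exp 1)"
    by (intro fps_expansion_intros) auto
qed

section \<open>Matched pairs\<close>

text \<open>
  The first three cumulants are \<open>a b - c\<close>, \<open>a b\<^sup>2\<close>, \<open>2 a b\<^sup>3\<close> for the gamma and \<open>r l\<close>,
  \<open>r l (1 + l)\<close>, \<open>r l (1 + l) (1 + 2 l)\<close> for the negative binomial distribution. Dividing the third
  equation by the second yields \<open>2 b = 1 + 2 l\<close>, the common parameter \<open>x\<close> of the two series below.
  The coefficients are read off after clearing the denominators of the generating functions.
\<close>
lemma matched_parameters:
  assumes "a > 0" "b > 0" "r > 0" "l \<ge> 0" "matched a b c r l"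
  shows "2 * b = 1 + 2 * l" "a * b - c = r * l" "a * b\<^sup>2 = r * l * (1 + l)"
proof -
  define F where "F = cumulant_fps (shifted_gamma a b c)"
  define N where "N = cumulant_fps (neg_binomial r l)"
  have F_eq: "F * (1 - fps_const b * fps_X) = fps_const (a * b - c) + fps_const (b * c) * fps_X"
  proof -
    define P where "P = 1 - fps_const b * fps_X"
    have "F * P = fps_const (- c) * P + fps_const (a * b) * (inverse P * P)"
      using assms by (simp add: F_def cumulant_fps_shifted_gamma P_def algebra_simps)
    also have "inverse P * P = 1"
      by (rule inverse_mult_eq_1) (simp add: P_def)
    finally show ?thesis
      by (simp add: P_def fps_eq_iff algebra_simps)
  qed
  have N_eq: "N * (fps_const (1 + l) - fps_const l * fps_exp 1) = fps_const (r * l) * fps_exp 1"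
  proof -
    define P where "P = fps_const (1 + l) - fps_const l * fps_exp 1"
    have "N * P = fps_const (r * l) * fps_exp 1 * (inverse P * P)"
      using assms by (simp add: N_def cumulant_fps_neg_binomial P_def algebra_simps)
    also have "inverse P * P = 1"
      by (rule inverse_mult_eq_1) (simp add: P_def)
    finally show ?thesis
      by (simp add: P_def)
  qed
  have F0: "fps_nth F 0 = a * b - c"
    using arg_cong[OF F_eq, of "\<lambda>F. fps_nth F 0"] by simp
  have "fps_nth F 1 = b * (c + fps_nth F 0)" "fps_nth F 2 = b * fps_nth F 1"
    using arg_cong[OF F_eq, of "\<lambda>F. fps_nth F 1"] arg_cong[OF F_eq, of "\<lambda>F. fps_nth F 2"]
    by (simp_all add: fps_mult_nth numeral_2_eq_2 algebra_simps)
  with F0 have F: "fps_nth F 0 = a * b - c" "fps_nth F 1 = a * b\<^sup>2" "fps_nth F 2 = b * (a * b\<^sup>2)"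
    by (simp_all add: power2_eq_square mult_ac)
  have N: "fps_nth N 0 = r * l" "fps_nth N 1 = r * l * (1 + l)"
      "fps_nth N 2 = r * l * (1 + l) * (1 + 2 * l) / 2"
    using arg_cong[OF N_eq, of "\<lambda>F. fps_nth F 0"] arg_cong[OF N_eq, of "\<lambda>F. fps_nth F 1"]
      arg_cong[OF N_eq, of "\<lambda>F. fps_nth F 2"]
    by (simp_all add: fps_mult_nth numeral_2_eq_2 power2_eq_square field_simps)
  have FN: "fps_nth F n = fps_nth N n" if "n \<in> {0, 1, 2}" for n
    using assms(5) that
    by (auto simp: matched_def F_def N_def cumulant_fps_def eval_nat_numeral)
  have eqs: "a * b - c = r * l" "a * b\<^sup>2 = r * l * (1 + l)"
      "b * (a * b\<^sup>2) = r * l * (1 + l) * (1 + 2 * l) / 2"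
    using FN[of 0] FN[of 1] FN[of 2] unfolding F N by simp_all
  have "(a * b\<^sup>2) * (2 * b) = 2 * (b * (a * b\<^sup>2))"
    by simp
  also have "\<dots> = (a * b\<^sup>2) * (1 + 2 * l)"
    unfolding eqs(3) unfolding eqs(2) by simp
  finally have "(a * b\<^sup>2) * (2 * b) = (a * b\<^sup>2) * (1 + 2 * l)" .
  moreover have "a * b\<^sup>2 \<noteq> 0"
    using assms by simp
  ultimately show "2 * b = 1 + 2 * l"
    by (metis mult_left_cancel)
  show "a * b - c = r * l" "a * b\<^sup>2 = r * l * (1 + l)"
    using eqs by simp_all
qed

text \<open>
  The exponential generating function of the scaled cumulants from the first one on: the factor \<open>2 ^ n\<close> is
  the substitution \<open>v \<mapsto> 2 v\<close>, up to one factor 2 because of the shift.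
\<close>
definition scaled_fps :: "real \<Rightarrow> real measure \<Rightarrow> real fps" where
  "scaled_fps r M = fps_const (2 / r) * (cumulant_fps M oo (fps_const 2 * fps_X))"

lemma scaled_fps_nth: "fps_nth (scaled_fps r M) n = 2 ^ (n + 1) / r * cumulant M (n + 1) / fact n"
  by (simp add: scaled_fps_def cumulant_fps_def)

text \<open>
  This is where matching enters. The generating function of the gamma cumulants always has a simple pole, here
  at \<open>1 / (2 b)\<close>; the matching conditions make it, after adding 1, exactly
  \<open>(x - v) / (1 - x * v)\<close> with \<open>x = 1 + 2 l\<close>.
\<close>
lemma scaled_gamma_fps_moebius:
  assumes "a > 0" "b > 0" "r > 0" "l \<ge> 0" "matched a b c r l"
  shows "(1 - fps_const (1 + 2 * l) * fps_X) * (1 + scaled_fps r (shifted_gamma a b c)) =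
         fps_const (1 + 2 * l) - fps_X"
proof -
  note p = matched_parameters[OF assms]
  define P where "P = 1 - fps_const (2 * b) * fps_X"
  have PP: "inverse P * P = 1"
    by (rule inverse_mult_eq_1) (simp add: P_def)
  have lin: "(1 - fps_const b * fps_X) oo (fps_const 2 * fps_X) = P"
    by (simp add: P_def fps_compose_sub_distrib fps_compose_mult_distrib mult.assoc
        flip: fps_const_mult)
  then have "inverse (1 - fps_const b * fps_X) oo (fps_const 2 * fps_X) = inverse P"
    by (subst fps_inverse_compose) auto
  then have "scaled_fps r (shifted_gamma a b c) =
     fps_const (2 / r) * (fps_const (- c) + fps_const (a * b) * inverse P)"
    using assms by (simp add: scaled_fps_def cumulant_fps_shifted_gamma fps_compose_add_distrib
        fps_compose_mult_distrib del: fps_const_neg fps_const_mult)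
  then have "P * (1 + scaled_fps r (shifted_gamma a b c)) =
     P + fps_const (2 / r) * (fps_const (- c) * P + fps_const (a * b) * (inverse P * P))"
    by (simp add: algebra_simps)
  also have "\<dots> = P + fps_const (2 / r) * (fps_const (- c) * P + fps_const (a * b))"
    by (simp add: PP)
  also have "\<dots> = fps_const (1 + 2 / r * (a * b - c)) - fps_const (2 * b - 4 * b * c / r) * fps_X"
    by (simp add: P_def fps_eq_iff field_simps fps_X_def)
  also have "2 / r * (a * b - c) = 2 * l"
    using p(2) assms by simp
  also have "2 * b - 4 * b * c / r = 1"
  proof -
    have c: "c = a * b - r * l"
      using p(2) by simp
    have "4 * b * c = 4 * (a * b\<^sup>2) - 2 * r * l * (2 * b)"
      unfolding c by (simp add: power2_eq_square algebra_simps)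
    also have "\<dots> = 2 * r * l"
      unfolding p(1,3) by (simp add: algebra_simps)
    finally have "4 * b * c / r = 2 * r * l / r"
      by (rule arg_cong[where f = "\<lambda>u. u / r"])
    then have "4 * b * c / r = 2 * l"
      using \<open>r > 0\<close> by simp
    then show ?thesis
      using p(1) by simp
  qed
  finally show ?thesis
    by (simp add: P_def p(1))
qed

text \<open>
  With \<open>P = 1 + l - l * exp (2 s)\<close> the series is \<open>V = 1 - P' / P\<close>, a logarithmic derivative, and
  \<open>P'' = 2 P'\<close>. This is the usual linearisation of a Riccati equation, here read backwards.
\<close>
lemma scaled_neg_binomial_fps_riccati:
  assumes r: "r > 0" and l: "l \<ge> 0"
  defines "V \<equiv> 1 + scaled_fps r (neg_binomial r l)"
  shows "fps_deriv V = V\<^sup>2 - 1" "fps_nth V 0 = 1 + 2 * l"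
proof -
  define P where "P = fps_const (1 + l) - fps_const l * fps_exp 2"
  have P0: "fps_nth P 0 = 1"
    by (simp add: P_def)
  have PP: "inverse P * P = 1"
    by (rule inverse_mult_eq_1) (simp add: P0)
  have P': "fps_deriv P = - (fps_const (2 * l) * fps_exp 2)" "fps_deriv (fps_deriv P) = 2 * fps_deriv P"
    by (simp_all add: P_def fps_eq_iff fps_numeral_nth)
  have "(fps_const (1 + l) - fps_const l * fps_exp 1) oo (fps_const 2 * fps_X) = P"
    by (simp add: P_def fps_compose_sub_distrib fps_compose_mult_distrib)
  then have "inverse (fps_const (1 + l) - fps_const l * fps_exp 1) oo (fps_const 2 * fps_X) = inverse P"
    by (subst fps_inverse_compose) auto
  then have "scaled_fps r (neg_binomial r l) = fps_const (2 / r) * (fps_const (r * l) * fps_exp 2 * inverse P)"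
    using r l by (simp add: scaled_fps_def cumulant_fps_neg_binomial fps_compose_mult_distrib
        del: fps_const_mult)
  also have "\<dots> = fps_const (2 / r * (r * l)) * fps_exp 2 * inverse P"
    by (simp only: mult.assoc flip: fps_const_mult)
  also have "2 / r * (r * l) = 2 * l"
    using r by simp
  also have "fps_const (2 * l) * fps_exp 2 * inverse P = - fps_deriv P * inverse P"
    by (simp only: P' minus_minus)
  finally have "V * P = P - fps_deriv P * (inverse P * P)"
    by (simp add: V_def algebra_simps)
  then have VP: "V * P = P - fps_deriv P"
    by (simp only: PP mult_1_right)
  have "fps_deriv V * P = fps_deriv (V * P) - V * fps_deriv P"
    by simp
  also have "\<dots> = fps_deriv P - 2 * fps_deriv P - V * fps_deriv P"
    by (simp only: VP fps_deriv_sub P'(2))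
  finally have V'P: "fps_deriv V * P = - fps_deriv P - V * fps_deriv P"
    by (simp only: mult_2) simp
  have "P\<^sup>2 * fps_deriv V = P * (fps_deriv V * P)"
    by (simp add: power2_eq_square mult_ac)
  also have "\<dots> = - fps_deriv P * (P + V * P)"
    unfolding V'P by (simp add: algebra_simps)
  also have "\<dots> = (V * P)\<^sup>2 - P\<^sup>2"
    unfolding VP by (simp add: algebra_simps power2_eq_square)
  also have "\<dots> = P\<^sup>2 * (V\<^sup>2 - 1)"
    by (simp add: algebra_simps power_mult_distrib)
  finally show "fps_deriv V = V\<^sup>2 - 1"
    using P0 by auto
  show "fps_nth V 0 = 1 + 2 * l"
    using arg_cong[OF VP, of "\<lambda>F. fps_nth F 0"] P0 by (simp add: P')
qed

lemma scaled_fps_compose_tanh: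
  assumes "a > 0" "b > 0" "r > 0" "l \<ge> 0" "matched a b c r l"
  shows "scaled_fps r (neg_binomial r l) = scaled_fps r (shifted_gamma a b c) oo fps_tanh"
proof -
  have "1 + scaled_fps r (neg_binomial r l) = (1 + scaled_fps r (shifted_gamma a b c)) oo fps_tanh"
    using riccati_compose_tanh scaled_gamma_fps_moebius[OF assms]
      scaled_neg_binomial_fps_riccati[OF assms(3,4)] .
  then show ?thesis
    by (simp add: fps_compose_add_distrib)
qed

theorem theorem4p3:
  fixes a b c r l :: real
  assumes "a > 0" and "b > 0" and "r > 0" and "l \<ge> 0"
    and "matched a b c r l"
  shows "\<forall>n. gamma_scaled a b c r (n + 1) = (\<Sum>i=0..n. theta n i * eta_scaled r l (i + 1)) \<and>
             eta_scaled r l (n + 1) = (\<Sum>i=0..n. Theta n i * gamma_scaled a b c r (i + 1))"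
proof (intro allI conjI)
  fix n
  define G where "G = scaled_fps r (shifted_gamma a b c)"
  define H where "H = scaled_fps r (neg_binomial r l)"
  have G: "gamma_scaled a b c r (i + 1) = fact i * fps_nth G i" for i
    by (simp add: G_def gamma_scaled_def scaled_fps_nth)
  have H: "eta_scaled r l (i + 1) = fact i * fps_nth H i" for i
    by (simp add: H_def eta_scaled_def scaled_fps_nth)
  have HG: "H = G oo fps_tanh"
    unfolding G_def H_def using assms by (rule scaled_fps_compose_tanh)
  then have "H oo fps_artanh = G oo (fps_tanh oo fps_artanh)"
    by (simp add: fps_compose_assoc)
  then have GH: "G = H oo fps_artanh"
    by (simp add: fps_tanh_compose_artanh)
  show "gamma_scaled a b c r (n + 1) = (\<Sum>i=0..n. theta n i * eta_scaled r l (i + 1))"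
    unfolding G H theta_eq
    by (subst GH) (simp add: fps_compose_nth sum_distrib_left mult_ac)
  show "eta_scaled r l (n + 1) = (\<Sum>i=0..n. Theta n i * gamma_scaled a b c r (i + 1))"
    unfolding G H Theta_eq
    by (subst HG) (simp add: fps_compose_nth sum_distrib_left mult_ac)
qed

end
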